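(* For any loopless graph $D$ on $n$ vertices, $\mathrm{s}[D^\circ, 2] \ge n/2$.
   Context: Graphs are finite and directed: $D=(V,E)$ with $V=\{1,\dots,n\}$, $n\ge 1$, $E\subseteq V^2$. A loop is an arc $(v,v)$; $D$ is loopless if it has no loops. For loopless $D$, $D^\circ$ is the graph obtained from $D$ by adding a loop on every vertex. Let $[2]=\{0,1\}$. For $f=(f_1,\dots,f_n):[2]^n\to[2]^n$, the interaction graph $G(f)$ has vertex set $V$ and an arc $(u,v)$ if and only if there exist $x,y\in[2]^n$ differing only in coordinate $u$ with $f_v(x)\ne f_v(y)$. For a graph $H$ on $V$, $\mathrm{F}[H,2]$ is the set of all $f:[2]^n\to[2]^n$ with $G(f)=H$. Let $d_{\mathrm H}$ be the Hamming distance and $\mathrm{s}(f)=\min_{x\in[2]^n}(n-d_{\mathrm H}(x,f(x)))$. Finally $\mathrm{s}[H,2]=\max_{f\in\mathrm{F}[H,2]}\mathrm{s}(f)$. *)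

theory Defs
  imports Complex_Main "HOL-Library.FuncSet"
begin

text \<open>
  A directed graph on the vertex set \<open>V = {1, ..., n}\<close> is given by \<open>n\<close> and its arc relation
  \<open>E \<subseteq> V \<times> V\<close>; a pair \<open>(u, v) \<in> E\<close> is an arc from \<open>u\<close> to \<open>v\<close>. It is loopless iff \<open>irrefl E\<close>.
\<close>

abbreviation verts :: "nat \<Rightarrow> nat set" where
  "verts n \<equiv> {1..n}"

definition add_loops :: "nat \<Rightarrow> nat rel \<Rightarrow> nat rel" where
  "add_loops n E = E \<union> Id_on (verts n)"

text \<open>
  The configuration space \<open>{0,1}\<^sup>n\<close>. Configurations, and the maps on them considered below, are
  extensional functions, so that equality of functions is equality on the intended domain.
\<close>

definition configs :: "nat \<Rightarrow> (nat \<Rightarrow> nat) set" where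
  "configs n = verts n \<rightarrow>\<^sub>E {0, 1}"

definition interaction_graph :: "nat \<Rightarrow> ((nat \<Rightarrow> nat) \<Rightarrow> (nat \<Rightarrow> nat)) \<Rightarrow> nat rel" where
  "interaction_graph n f =
    {(u, v). u \<in> verts n \<and> v \<in> verts n \<and>
      (\<exists>x\<in>configs n. \<exists>y\<in>configs n. x u \<noteq> y u \<and> (\<forall>w\<in>verts n - {u}. x w = y w) \<and> f x v \<noteq> f y v)}"

definition functions_with_graph :: "nat \<Rightarrow> nat rel \<Rightarrow> ((nat \<Rightarrow> nat) \<Rightarrow> (nat \<Rightarrow> nat)) set" where
  "functions_with_graph n H = {f \<in> configs n \<rightarrow>\<^sub>E configs n. interaction_graph n f = H}"

definition hamming_dist :: "nat \<Rightarrow> (nat \<Rightarrow> nat) \<Rightarrow> (nat \<Rightarrow> nat) \<Rightarrow> nat" where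
  "hamming_dist n x y = card {v \<in> verts n. x v \<noteq> y v}"

text \<open>The subtraction below never truncates, since \<open>hamming_dist n x y \<le> n\<close>.\<close>

definition stability :: "nat \<Rightarrow> ((nat \<Rightarrow> nat) \<Rightarrow> (nat \<Rightarrow> nat)) \<Rightarrow> nat" where
  "stability n f = Min ((\<lambda>x. n - hamming_dist n x (f x)) ` configs n)"

text \<open>
  The sets of functions considered are finite. For \<open>H = add_loops n E\<close> with \<open>E \<subseteq> V \<times> V\<close> the set is
  also nonempty (take for \<open>f\<^sub>v\<close> the sum modulo 2 over the in-neighbours of \<open>v\<close>), so the maximum is
  a genuine one.
\<close>

definition graph_stability :: "nat \<Rightarrow> nat rel \<Rightarrow> nat" where
  "graph_stability n H = Max (stability n ` functions_with_graph n H)"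

end

theory Submission imports Defs
begin

text \<open>
  Give each vertex \<open>v\<close> with an in-neighbour a pattern on its closed in-neighbourhood, prescribing
  \<open>0\<close> at \<open>v\<close>, and let \<open>f\<^sub>v\<close> flip \<open>x\<^sub>v\<close> exactly when \<open>x\<close> agrees with this pattern. Two vertices
  whose patterns disagree somewhere never flip together. Only one value of each pattern matters,
  the one at a chosen in-neighbour \<open>\<phi> v\<close>. It is found by induction on the graph of the partial
  function \<open>\<phi>\<close>. Let \<open>v\<close> be a leaf with parent \<open>u\<close>. If \<open>v\<close> is the only child of \<open>u\<close>, let \<open>u\<close> and \<open>v\<close>
  conflict and delete both. If \<open>w\<close> is another child of \<open>u\<close>, make \<open>w\<close> a child of \<open>v\<close> instead.
  If there is no leaf, \<open>\<phi>\<close> is a fixed-point-free permutation; prescribing \<open>1\<close> at all parents makes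
  the set of flipping vertices disjoint from its image under \<open>\<phi>\<close>.
\<close>

lemma two_card_le_if_image_disjoint:
  assumes "finite V" "F \<subseteq> V" "f ` F \<subseteq> V" "inj_on f F" "F \<inter> f ` F = {}"
  shows "2 * card F \<le> card V"
proof -
  have fin: "finite F" using assms by (meson finite_subset)
  have "2 * card F = card F + card (f ` F)" using assms(4) by (simp add: card_image)
  also have "\<dots> = card (F \<union> f ` F)" using assms fin by (simp add: card_Un_disjoint)
  also have "\<dots> \<le> card V" using assms by (intro card_mono) auto
  finally show ?thesis .
qed

text \<open>\<open>W\<close> holds the vertices that may flip, and \<open>b v\<close> is the value
  prescribed at the parent \<open>\<phi> v\<close>. Dropping the digraph from the statement lets the
  induction redirect \<open>\<phi>\<close> along pairs that are not arcs.\<close>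

lemma half_flip_bound:
  fixes V W :: "'a set" and \<phi> :: "'a \<Rightarrow> 'a"
  assumes "finite V" "W \<subseteq> V" "\<phi> ` W \<subseteq> V" "\<And>v. v \<in> W \<Longrightarrow> \<phi> v \<noteq> v"
  shows "\<exists>b :: 'a \<Rightarrow> bool. \<forall>x :: 'a \<Rightarrow> bool. 2 * card {v \<in> W. \<not> x v \<and> x (\<phi> v) = b v} \<le> card V"
  using assms
proof (induction "card V" arbitrary: V W \<phi> rule: less_induct)
  case outer: less
  show ?case
    using outer.prems
  \<comment> \<open>Redirecting a child keeps \<open>V\<close> and \<open>W\<close> and lowers the
    number of leaves. Deleting a pair need not lower that number, but it shrinks \<open>V\<close>,
    which is what the outer induction is for.\<close>
  proof (induction "card (W - \<phi> ` W)" arbitrary: \<phi> rule: less_induct)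
    case (less \<phi>)
    have finW: "finite W" using less.prems by (meson finite_subset)
    show ?case
    proof (cases "W \<subseteq> \<phi> ` W")
      case True
      then have surj: "card (\<phi> ` W) = card W"
        using finW by (meson card_image_le card_mono finite_imageI le_antisym)
      then have inj: "inj_on \<phi> W" using finW by (simp add: eq_card_imp_inj_on)
      \<comment> \<open>\<open>x\<close> is false on the flipping vertices and true on their
        parents, so the two sets are disjoint.\<close>
      have "2 * card {v \<in> W. \<not> x v \<and> x (\<phi> v) = True} \<le> card V" for x
        using less.prems by (intro two_card_le_if_image_disjoint[where f = \<phi>] inj_on_subset[OF inj]) auto
      then show ?thesis by (intro exI[of _ "\<lambda>_. True"]) blast
    next
      case False
      then obtain v where v: "v \<in> W" "v \<notin> \<phi> ` W" by blast
      define u where "u = \<phi> v"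
      have u: "u \<in> V" "u \<noteq> v" using v less.prems u_def by auto
      show ?thesis
      proof (cases "\<exists>w\<in>W. w \<noteq> v \<and> \<phi> w = u")
        case True
        then obtain w where w: "w \<in> W" "w \<noteq> v" "\<phi> w = u" by blast
        \<comment> \<open>The leaf \<open>v\<close> gains the child \<open>w\<close>, and
          \<open>u\<close> keeps the child \<open>v\<close>, so no new leaf arises.\<close>
        define \<phi>' where "\<phi>' = \<phi>(w := v)"
        have sub: "W - \<phi>' ` W \<subset> W - \<phi> ` W"
        proof
          show "W - \<phi>' ` W \<subseteq> W - \<phi> ` W"
          proof
            fix z assume z: "z \<in> W - \<phi>' ` W"
            have "z \<notin> \<phi> ` W"
            proof
              assume "z \<in> \<phi> ` W"
              then obtain t where t: "t \<in> W" "z = \<phi> t" by blast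
              then have "z = \<phi>' (if t = w then v else t)"
                using w by (simp add: \<phi>'_def u_def)
              then show False using z t(1) v(1) by (auto split: if_splits)
            qed
            then show "z \<in> W - \<phi> ` W" using z by blast
          qed
          have "v = \<phi>' w" by (simp add: \<phi>'_def)
          then have "v \<in> \<phi>' ` W" using w(1) by blast
          then show "W - \<phi>' ` W \<noteq> W - \<phi> ` W" using v by blast
        qed
        have "card (W - \<phi>' ` W) < card (W - \<phi> ` W)"
          using finW sub by (intro psubset_card_mono) auto
        moreover have "\<phi>' ` W \<subseteq> V" "\<And>z. z \<in> W \<Longrightarrow> \<phi>' z \<noteq> z"
          using less.prems v w by (auto simp: \<phi>'_def)
        ultimately obtain b' :: "'a \<Rightarrow> bool" where
          b': "\<And>x :: 'a \<Rightarrow> bool. 2 * card {z \<in> W. \<not> x z \<and> x (\<phi>' z) = b' z} \<le> card V"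
          using less.hyps[of \<phi>'] less.prems by blast
        \<comment> \<open>Resetting \<open>x\<close> at \<open>v\<close> so that \<open>v\<close>
          flips for \<open>\<phi>'\<close> and \<open>b'\<close> iff \<open>x u = b' v\<close> makes
          the value at \<open>v\<close> encode the value at \<open>u\<close>. The condition
          \<open>x' v = b' w\<close> then reads \<open>x u = (b' w \<noteq> b' v)\<close>, which is
          \<open>b\<close> at \<open>w\<close>. No other vertex reads \<open>v\<close>, since
          \<open>v\<close> is a leaf of \<open>\<phi>\<close>.\<close>
        define b where "b = b'(w := (b' w \<noteq> b' v))"
        have "2 * card {z \<in> W. \<not> x z \<and> x (\<phi> z) = b z} \<le> card V" for x
        proof -
          define x' where "x' = x(v := (x u \<noteq> b' v))"
          have "{z \<in> W. \<not> x z \<and> x (\<phi> z) = b z} \<subseteq> {z \<in> W. \<not> x' z \<and> x' (\<phi>' z) = b' z}"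
          proof
            fix z assume "z \<in> {z \<in> W. \<not> x z \<and> x (\<phi> z) = b z}"
            then have z: "z \<in> W" "\<not> x z" "x (\<phi> z) = b z" by auto
            have nv: "\<phi> z \<noteq> v" using v z(1) by blast
            have "x' (\<phi>' z) = b' z"
              using z(3) nv w by (cases "z = w") (auto simp: x'_def b_def \<phi>'_def)
            moreover have "\<not> x' z"
              using z w by (cases "z = v") (auto simp: x'_def b_def u_def)
            ultimately show "z \<in> {z \<in> W. \<not> x' z \<and> x' (\<phi>' z) = b' z}" using z(1) by blast
          qed
          then have "card {z \<in> W. \<not> x z \<and> x (\<phi> z) = b z}
              \<le> card {z \<in> W. \<not> x' z \<and> x' (\<phi>' z) = b' z}"
            using finW by (intro card_mono) auto
          then show ?thesis using b'[of x'] by linarith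
        qed
        then show ?thesis by blast
      next
        case False
        define V' W' where "V' = V - {u, v}" and "W' = W - {u, v}"
        have uv: "{u, v} \<subseteq> V" "card {u, v} = 2" using u v less.prems by auto
        have cV: "card V = card V' + 2"
          using uv less.prems(1) card_mono[OF less.prems(1) uv(1)]
          by (simp add: V'_def card_Diff_subset)
        \<comment> \<open>\<open>v\<close> is nobody's parent, and the only child of
          \<open>u\<close> is deleted with it.\<close>
        have "\<phi> ` W' \<subseteq> V'"
          using less.prems False v by (auto simp: W'_def V'_def)
        then obtain b' :: "'a \<Rightarrow> bool" where
          b': "\<And>x :: 'a \<Rightarrow> bool. 2 * card {z \<in> W'. \<not> x z \<and> x (\<phi> z) = b' z} \<le> card V'"
          using outer.hyps[of V' W' \<phi>] less.prems cV
          by (auto simp: V'_def W'_def)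
        \<comment> \<open>Now \<open>v\<close> flips only if \<open>x u\<close> holds and
          \<open>u\<close> only if it fails, so the deleted pair contributes at most one flip, that
          of \<open>t\<close>.\<close>
        define b where "b = b'(v := True)"
        have "2 * card {z \<in> W. \<not> x z \<and> x (\<phi> z) = b z} \<le> card V" for x
        proof -
          define t where "t = (if x u then v else u)"
          have "{z \<in> W. \<not> x z \<and> x (\<phi> z) = b z}
              \<subseteq> insert t {z \<in> W'. \<not> x z \<and> x (\<phi> z) = b' z}"
            by (auto simp: t_def W'_def b_def u_def)
          then have "card {z \<in> W. \<not> x z \<and> x (\<phi> z) = b z}
              \<le> card (insert t {z \<in> W'. \<not> x z \<and> x (\<phi> z) = b' z})"
            using finW by (intro card_mono) (auto simp: W'_def)
          also have "\<dots> \<le> Suc (card {z \<in> W'. \<not> x z \<and> x (\<phi> z) = b' z})"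
            by (rule card_insert_le_m1) auto
          finally show ?thesis using b'[of x] cV by linarith
        qed
        then show ?thesis by blast
      qed
    qed
  qed
qed

lemma finite_configs: "finite (configs n)"
  unfolding configs_def by (intro finite_PiE) auto

lemma finite_functions_with_graph: "finite (functions_with_graph n H)"
proof -
  have "finite (configs n \<rightarrow>\<^sub>E configs n)" by (intro finite_PiE finite_configs)
  then show ?thesis by (simp add: functions_with_graph_def)
qed

lemma configs_nonempty: "configs n \<noteq> {}"
  by (auto simp: configs_def PiE_eq_empty_iff)

lemma config_values: "x \<in> configs n \<Longrightarrow> v \<in> verts n \<Longrightarrow> x v = 0 \<or> x v = 1"
  by (auto simp: configs_def PiE_def Pi_def)

text \<open>A vertex outside \<open>Range E\<close> must copy its own value: with an empty pattern
  on its in-neighbours it would be constantly 1 and lose its loop.\<close>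

definition pattern_map :: "nat \<Rightarrow> nat rel \<Rightarrow> (nat \<Rightarrow> nat \<Rightarrow> nat) \<Rightarrow> (nat \<Rightarrow> nat) \<Rightarrow> nat \<Rightarrow> nat" where
  "pattern_map n E p = (\<lambda>x\<in>configs n. \<lambda>v\<in>verts n.
     if v \<in> Range E \<and> x v = 0 \<and> (\<forall>u. (u, v) \<in> E \<longrightarrow> x u = p v u) then 1 else x v)"

lemma pattern_map_in_PiE: "pattern_map n E p \<in> configs n \<rightarrow>\<^sub>E configs n"
proof -
  have "pattern_map n E p x \<in> configs n" if "x \<in> configs n" for x
    using that config_values[OF that] by (auto simp: pattern_map_def configs_def)
  then show ?thesis by (auto simp: pattern_map_def)
qed

text \<open>The graph is the same for every choice of \<open>p\<close>, which leaves
  \<open>p\<close> free for bounding the number of flips.\<close>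

lemma interaction_graph_pattern_map:
  assumes E: "E \<subseteq> verts n \<times> verts n" and irr: "irrefl E" and p: "\<And>v u. p v u \<in> {0, 1}"
  shows "interaction_graph n (pattern_map n E p) = add_loops n E"
proof (intro equalityI subrelI)
  fix u v assume "(u, v) \<in> interaction_graph n (pattern_map n E p)"
  then obtain x y where uv: "u \<in> verts n" "v \<in> verts n"
    and xy: "x \<in> configs n" "y \<in> configs n" "\<forall>w\<in>verts n - {u}. x w = y w"
      "pattern_map n E p x v \<noteq> pattern_map n E p y v"
    unfolding interaction_graph_def by blast
  show "(u, v) \<in> add_loops n E"
  proof (rule ccontr)
    assume "(u, v) \<notin> add_loops n E"
    then have ne: "u \<noteq> v" "(u, v) \<notin> E" using uv by (auto simp: add_loops_def)
    have "x v = y v" using xy(3) uv ne by blast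
    moreover have "x w = y w" if "(w, v) \<in> E" for w using xy(3) that E ne by blast
    then have "(\<forall>u. (u, v) \<in> E \<longrightarrow> x u = p v u) \<longleftrightarrow> (\<forall>u. (u, v) \<in> E \<longrightarrow> y u = p v u)" by metis
    ultimately have "pattern_map n E p x v = pattern_map n E p y v"
      using xy(1,2) uv(2) by (simp only: pattern_map_def restrict_apply' if_True)
    then show False using xy(4) by contradiction
  qed
next
  have arcI: "(u, v) \<in> interaction_graph n (pattern_map n E p)"
    if "u \<in> verts n" "v \<in> verts n" "x \<in> configs n" "y \<in> configs n" "x u \<noteq> y u"
      "\<And>w. w \<in> verts n \<Longrightarrow> w \<noteq> u \<Longrightarrow> x w = y w"
      "pattern_map n E p x v \<noteq> pattern_map n E p y v" for u v x y
    using that unfolding interaction_graph_def by blast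
  have conf: "(\<lambda>w\<in>verts n. g w) \<in> configs n" if "\<And>w. g w \<in> {0, 1}" for g
    using that by (auto simp: configs_def)
  fix u v assume "(u, v) \<in> add_loops n E"
  then consider "u = v" "v \<in> verts n" | "(u, v) \<in> E" by (auto simp: add_loops_def)
  then show "(u, v) \<in> interaction_graph n (pattern_map n E p)"
  proof cases
    case 1
    \<comment> \<open>Off \<open>v\<close> the pattern is complemented, so any in-neighbour violates
      it and \<open>v\<close> keeps its value \<open>c\<close>.\<close>
    define x where "x c = (\<lambda>w\<in>verts n. if w = v then c else 1 - p v w)" for c :: nat
    have xc: "x 0 \<in> configs n" "x 1 \<in> configs n"
      unfolding x_def by (intro conf; simp; arith)+
    have "pattern_map n E p (x c) v = c" if "x c \<in> configs n" for c
    proof -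
      have "\<not> (\<forall>u. (u, v) \<in> E \<longrightarrow> x c u = p v u)" if R: "v \<in> Range E"
      proof -
        obtain w where w: "(w, v) \<in> E" using R by blast
        then have "w \<noteq> v" "w \<in> verts n" using irr E by (auto simp: irrefl_def)
        then have "x c w = 1 - p v w" by (simp add: x_def)
        then show ?thesis using w p[of v w] by (metis diff_zero diff_self_eq_0 insertE singletonD zero_neq_one)
      qed
      then show ?thesis using that 1 by (auto simp: pattern_map_def x_def)
    qed
    then show ?thesis using 1 xc by (intro arcI[of u v "x 0" "x 1"]) (auto simp: x_def)
  next
    case 2
    then have uv: "u \<in> verts n" "v \<in> verts n" "u \<noteq> v" using E irr by (auto simp: irrefl_def)
    \<comment> \<open>\<open>x\<close> realises the whole pattern of \<open>v\<close>, and
      \<open>y\<close> breaks it at \<open>u\<close> alone.\<close>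
    define x where "x = (\<lambda>w\<in>verts n. if w = v then 0 else p v w)"
    define y where "y = (\<lambda>w\<in>verts n. if w = v then 0 else if w = u then 1 - p v u else p v w)"
    have xy: "x \<in> configs n" "y \<in> configs n"
      unfolding x_def y_def by (intro conf; use p[of v] in \<open>force\<close>)+
    have yu: "y u \<noteq> p v u" "x u = p v u"
      using uv p[of v u] by (auto simp: y_def x_def)
    have "x w = p v w" if "(w, v) \<in> E" for w
      using that E irr by (auto simp: x_def irrefl_def)
    then have "pattern_map n E p x v = 1"
      using xy uv 2 by (auto simp: pattern_map_def x_def)
    moreover have "pattern_map n E p y v = 0"
      using xy uv 2 yu by (auto simp: pattern_map_def y_def)
    ultimately show ?thesis using uv xy yu by (intro arcI[of u v x y]) (auto simp: x_def y_def)
  qed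
qed

lemma graph_stability_ge:
  assumes "f \<in> functions_with_graph n H"
    and "\<And>x. x \<in> configs n \<Longrightarrow> k \<le> n - hamming_dist n x (f x)"
  shows "k \<le> graph_stability n H"
proof -
  have "k \<le> stability n f"
    unfolding stability_def using assms(2) by (simp add: finite_configs configs_nonempty)
  also have "\<dots> \<le> graph_stability n H"
    unfolding graph_stability_def using assms(1) by (simp add: finite_functions_with_graph)
  finally show ?thesis .
qed

theorem theorem3p3:
  fixes n :: nat and E :: "nat rel"
  assumes "n \<ge> 1"
    and "E \<subseteq> verts n \<times> verts n"
    and "irrefl E"
  shows "real (graph_stability n (add_loops n E)) \<ge> real n / 2"
proof -
  define \<phi> where "\<phi> v = (SOME u. (u, v) \<in> E)" for v
  have \<phi>: "(\<phi> v, v) \<in> E" if "v \<in> Range E" for v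
    using that unfolding \<phi>_def by (auto intro: someI)
  have \<phi>V: "\<phi> v \<in> verts n" "\<phi> v \<noteq> v" if "v \<in> Range E" for v
    using \<phi>[OF that] assms(2,3) by (auto simp: irrefl_def)
  have "Range E \<subseteq> verts n" "\<phi> ` Range E \<subseteq> verts n" using assms(2) \<phi>V by blast+
  then obtain b :: "nat \<Rightarrow> bool" where
    b: "\<And>x :: nat \<Rightarrow> bool. 2 * card {v \<in> Range E. \<not> x v \<and> x (\<phi> v) = b v} \<le> n"
    using half_flip_bound[of "verts n" "Range E" \<phi>] \<phi>V(2) by auto
  \<comment> \<open>Only the value at \<open>\<phi> v\<close> is used to bound the flips; the
    default 1 elsewhere adds conditions, which can only prevent flips.\<close>
  define p where "p v u = (if u = \<phi> v then of_bool (b v) else 1 :: nat)" for v u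
  define f where "f = pattern_map n E p"
  have "f \<in> functions_with_graph n (add_loops n E)"
    unfolding functions_with_graph_def f_def
    using pattern_map_in_PiE interaction_graph_pattern_map[OF assms(2,3), of p]
    by (simp add: p_def)
  \<comment> \<open>At most \<open>n div 2\<close> vertices flip, so at least the rounded-up half of
    them stay fixed.\<close>
  moreover have "(n + 1) div 2 \<le> n - hamming_dist n x (f x)" if x: "x \<in> configs n" for x
  proof -
    \<comment> \<open>Of the whole pattern, only the conditions at \<open>v\<close> and at
      \<open>\<phi> v\<close> are kept.\<close>
    have "{v \<in> verts n. x v \<noteq> f x v}
        \<subseteq> {v \<in> Range E. \<not> x v = 1 \<and> (x (\<phi> v) = 1) = b v}"
      using x \<phi> by (auto simp: f_def pattern_map_def p_def split: if_splits)
    moreover have "finite {v \<in> Range E. \<not> x v = 1 \<and> (x (\<phi> v) = 1) = b v}"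
      by (rule finite_subset[OF _ finite_atLeastAtMost[of 1 n]])
        (use \<open>Range E \<subseteq> verts n\<close> in auto)
    ultimately have "hamming_dist n x (f x) \<le> card {v \<in> Range E. \<not> x v = 1 \<and> (x (\<phi> v) = 1) = b v}"
      unfolding hamming_dist_def by (intro card_mono)
    then show ?thesis using b[of "\<lambda>v. x v = 1"] by linarith
  qed
  ultimately have "(n + 1) div 2 \<le> graph_stability n (add_loops n E)"
    by (rule graph_stability_ge)
  then have "n \<le> 2 * graph_stability n (add_loops n E)" by linarith
  then have "real n \<le> real (2 * graph_stability n (add_loops n E))" by (simp only: of_nat_le_iff)
  then show ?thesis by simp
qed

end
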